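(* Let $G=(X\cup Y,E)$ be a bipartite graph that is subset-uniform with respect to a partition $\mathcal{I}$ of $X$, and let $a^T(x,y,z)\le b$ be a valid inequality for $P(G,\mathcal{I})$. Then every copying of this inequality is also valid for $P(G,\mathcal{I})$.
   Context: $G=(X\cup Y,E)$ is a finite bipartite graph with disjoint node sets $X,Y$; every edge $\{i,j\}\in E$ has $i\in X$, $j\in Y$. $\mathcal{I}$ is a partition of $X$ into non-empty subsets. $N(v)$ is the set of neighbours of $v$. Vectors in $\mathbb{R}^{X\cup Y\cup E}$ are written $(x,y,z)$. Put $X^{\mathcal{I}}=\{x\in\{0,1\}^X : \sum_{i\in I}x_i\le 1\ \forall I\in\mathcal{I}\}$ and $$P(G,\mathcal{I})=\operatorname{conv}\{(x,y,z)\in\{0,1\}^{X\cup Y\cup E} : x_iy_j=z_{ij}\ \forall\{i,j\}\in E,\ x\in X^{\mathcal{I}}\}.$$ $G$ is subset-uniform with respect to $\mathcal{I}$ if any two nodes in the same subset $I\in\mathcal{I}$ have the same neighbourhood in $Y$; denote this common neighbourhood by $N_I$. Copying: for an inequality $a^T(x,y,z)\le b$, $I\in\mathcal{I}$ and $i\in I$, let $r_i=(a_i,(a_{ij})_{j\in N_I})\in\mathbb{R}^{1+|N_I|}$ be the tuple of coefficients of node $i$ and its incident edges, and let $H^I=\{r_i: i\in I\}$. A copying of the inequality is any inequality $\hat a^T(x,y,z)\le b$ with $\hat a_j=a_j$ for all $j\in Y$ in which, for each $I\in\mathcal{I}$ and each $i\in I$, the tuple $r_i$ is replaced by some tuple in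 $H^I$. *)

theory Defs
  imports "HOL-Analysis.Finite_Function_Topology" "HOL-Analysis.Analysis" "HOL-Library.Disjoint_Sets"
begin

definition finite_bipartite_graph :: "'v set \<Rightarrow> 'v set \<Rightarrow> 'v set set \<Rightarrow> bool" where
  "finite_bipartite_graph X Y E \<longleftrightarrow>
     finite X \<and> finite Y \<and> X \<inter> Y = {} \<and> (\<forall>e\<in>E. \<exists>i\<in>X. \<exists>j\<in>Y. e = {i, j})"

definition nbhd :: "'v set set \<Rightarrow> 'v \<Rightarrow> 'v set" where
  "nbhd E v = {w. {v, w} \<in> E}"

definition subset_uniform :: "'v set set \<Rightarrow> 'v set set \<Rightarrow> bool" where
  "subset_uniform E \<I> \<longleftrightarrow> (\<forall>I\<in>\<I>. \<forall>i\<in>I. \<forall>k\<in>I. nbhd E i = nbhd E k)"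

text \<open>Only meaningful when \<open>I\<close> is non-empty and all its nodes have the same neighbourhood.\<close>
definition common_nbhd :: "'v set set \<Rightarrow> 'v set \<Rightarrow> 'v set" where
  "common_nbhd E I = (THE N. \<forall>i\<in>I. nbhd E i = N)"

text \<open>A vector \<open>(x, y, z)\<close> indexed by \<open>X \<union> Y \<union> E\<close> is a triple of finitely supported functions
  whose supports lie in \<open>X\<close>, \<open>Y\<close> and \<open>E\<close>. Such triples form a real vector space in the library,
  so that \<^const>\<open>hull\<close> and \<^const>\<open>convex\<close> apply, although \<open>X\<close>, \<open>Y\<close> and \<open>E\<close> are sets, not types.\<close>
type_synonym 'v xyz_vec = "('v \<Rightarrow>\<^sub>0 real) \<times> ('v \<Rightarrow>\<^sub>0 real) \<times> ('v set \<Rightarrow>\<^sub>0 real)"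

definition vec_space :: "'v set \<Rightarrow> 'v set \<Rightarrow> 'v set set \<Rightarrow> 'v xyz_vec set" where
  "vec_space X Y E = {(x, y, z).
     Poly_Mapping.keys x \<subseteq> X \<and> Poly_Mapping.keys y \<subseteq> Y \<and> Poly_Mapping.keys z \<subseteq> E}"

definition binary_vecs :: "'v set \<Rightarrow> 'v set \<Rightarrow> 'v set set \<Rightarrow> 'v xyz_vec set" where
  "binary_vecs X Y E = {(x, y, z). (x, y, z) \<in> vec_space X Y E \<and>
     (\<forall>i\<in>X. Poly_Mapping.lookup x i \<in> {0, 1}) \<and>
     (\<forall>j\<in>Y. Poly_Mapping.lookup y j \<in> {0, 1}) \<and>
     (\<forall>e\<in>E. Poly_Mapping.lookup z e \<in> {0, 1})}"

definition X_part :: "'v set \<Rightarrow> 'v set set \<Rightarrow> ('v \<Rightarrow>\<^sub>0 real) set" where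
  "X_part X \<I> = {x.
     Poly_Mapping.keys x \<subseteq> X \<and> (\<forall>i\<in>X. Poly_Mapping.lookup x i \<in> {0, 1}) \<and>
     (\<forall>I\<in>\<I>. (\<Sum>i\<in>I. Poly_Mapping.lookup x i) \<le> 1)}"

definition bipartite_polytope :: "'v set \<Rightarrow> 'v set \<Rightarrow> 'v set set \<Rightarrow> 'v set set \<Rightarrow> 'v xyz_vec set" where
  "bipartite_polytope X Y E \<I> = convex hull {(x, y, z). (x, y, z) \<in> binary_vecs X Y E \<and>
     (\<forall>i\<in>X. \<forall>j\<in>Y. {i, j} \<in> E \<longrightarrow>
       Poly_Mapping.lookup x i * Poly_Mapping.lookup y j = Poly_Mapping.lookup z {i, j}) \<and>
     x \<in> X_part X \<I>}"

definition scalar_prod :: "'v set \<Rightarrow> 'v set \<Rightarrow> 'v set set \<Rightarrow> 'v xyz_vec \<Rightarrow> 'v xyz_vec \<Rightarrow> real" where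
  "scalar_prod X Y E = (\<lambda>(a, b, c) (x, y, z).
     (\<Sum>i\<in>X. Poly_Mapping.lookup a i * Poly_Mapping.lookup x i) +
     (\<Sum>j\<in>Y. Poly_Mapping.lookup b j * Poly_Mapping.lookup y j) +
     (\<Sum>e\<in>E. Poly_Mapping.lookup c e * Poly_Mapping.lookup z e))"

definition valid_ineq ::
  "'v set \<Rightarrow> 'v set \<Rightarrow> 'v set set \<Rightarrow> 'v set set \<Rightarrow> 'v xyz_vec \<Rightarrow> real \<Rightarrow> bool" where
  "valid_ineq X Y E \<I> a b \<longleftrightarrow> (\<forall>v\<in>bipartite_polytope X Y E \<I>. scalar_prod X Y E a v \<le> b)"

text \<open>The tuple \<open>r\<^sub>i\<close>, with \<open>N\<close> the common neighbourhood of the subset containing \<open>i\<close>. The second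
  component is the family of the coefficients of the edges \<open>{i, j}\<close>, indexed by \<open>j \<in> N\<close>.\<close>
definition coeff_tuple :: "'v set \<Rightarrow> 'v xyz_vec \<Rightarrow> 'v \<Rightarrow> real \<times> ('v \<Rightarrow> real)" where
  "coeff_tuple N = (\<lambda>(aX, aY, aE) i. (Poly_Mapping.lookup aX i, \<lambda>j\<in>N. Poly_Mapping.lookup aE {i, j}))"

definition coeff_tuples :: "'v set set \<Rightarrow> 'v xyz_vec \<Rightarrow> 'v set \<Rightarrow> (real \<times> ('v \<Rightarrow> real)) set" where
  "coeff_tuples E a I = {coeff_tuple (common_nbhd E I) a i | i. i \<in> I}"

text \<open>\<open>is_copying X Y E \<I> a a'\<close>: the inequality with coefficients \<open>a'\<close> is a copying of the one with
  coefficients \<open>a\<close>. The right-hand side of the inequality is the same for both.\<close>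
definition is_copying ::
  "'v set \<Rightarrow> 'v set \<Rightarrow> 'v set set \<Rightarrow> 'v set set \<Rightarrow> 'v xyz_vec \<Rightarrow> 'v xyz_vec \<Rightarrow> bool" where
  "is_copying X Y E \<I> a a' \<longleftrightarrow>
     a' \<in> vec_space X Y E \<and>
     (\<forall>j\<in>Y. Poly_Mapping.lookup (fst (snd a')) j = Poly_Mapping.lookup (fst (snd a)) j) \<and>
     (\<forall>I\<in>\<I>. \<forall>i\<in>I. coeff_tuple (common_nbhd E I) a' i \<in> coeff_tuples E a I)"

end

(* A copying is given by a map \<phi> on X that preserves every subset of the partition, with the
   coefficients of node i in the copying being those of node \<phi> i in the original. At a vertex
   (x, y, z) the copying therefore takes the value that the original takes at the vertex (x', y, z'),
   where x' is the push-forward of x along \<phi> and z' is the product of x' and y on the edges. *)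

theory Submission
  imports Defs
begin

abbreviation "lookup \<equiv> Poly_Mapping.lookup"
abbreviation "keys \<equiv> Poly_Mapping.keys"

section \<open>Reduction of validity to the points that generate the polytope\<close>

definition polytope_vertices :: "'v set \<Rightarrow> 'v set \<Rightarrow> 'v set set \<Rightarrow> 'v set set \<Rightarrow> 'v xyz_vec set" where
  "polytope_vertices X Y E \<I> = {(x, y, z). (x, y, z) \<in> binary_vecs X Y E \<and>
     (\<forall>i\<in>X. \<forall>j\<in>Y. {i, j} \<in> E \<longrightarrow> lookup x i * lookup y j = lookup z {i, j}) \<and>
     x \<in> X_part X \<I>}"

lemma ex_poly_mapping_on:
  assumes "finite A"
  shows "\<exists>p. keys p \<subseteq> A \<and> (\<forall>i\<in>A. lookup p i = f i)"
proof -
  let ?g = "\<lambda>i. if i \<in> A then f i else 0"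
  have "finite {i. ?g i \<noteq> 0}"
    by (rule finite_subset[OF _ assms]) auto
  hence "lookup (Abs_poly_mapping ?g) = ?g"
    by (rule lookup_Abs_poly_mapping)
  thus ?thesis
    by (intro exI[of _ "Abs_poly_mapping ?g"]) (auto simp: in_keys_iff split: if_splits)
qed

lemma lookup_scaleR_poly_mapping: "lookup (r *\<^sub>R p) i = r *\<^sub>R lookup p i"
proof -
  have "finite {i. r *\<^sub>R lookup p i \<noteq> 0}"
    by (rule finite_subset[OF _ finite_keys[of p]]) (auto simp: in_keys_iff)
  thus ?thesis by (simp add: scaleR_poly_mapping_def lookup_Abs_poly_mapping)
qed

lemma scalar_prod_convex_combination:
  "scalar_prod X Y E a (s *\<^sub>R v + t *\<^sub>R w) = s * scalar_prod X Y E a v + t * scalar_prod X Y E a w"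
  by (cases a; cases v; cases w)
    (simp add: scalar_prod_def lookup_add lookup_scaleR_poly_mapping sum.distrib sum_distrib_left algebra_simps)

lemma convex_scalar_prod_le: "convex {v. scalar_prod X Y E a v \<le> b}"
  unfolding convex_def mem_Collect_eq scalar_prod_convex_combination
  by (blast intro: convex_bound_le)

text \<open>A half-space is convex, so it contains the hull as soon as it contains the generating
  points.\<close>

lemma valid_ineq_iff_vertices:
  "valid_ineq X Y E \<I> a b \<longleftrightarrow> (\<forall>v\<in>polytope_vertices X Y E \<I>. scalar_prod X Y E a v \<le> b)"
proof -
  have hull: "bipartite_polytope X Y E \<I> = convex hull (polytope_vertices X Y E \<I>)"
    by (simp add: bipartite_polytope_def polytope_vertices_def)
  have "valid_ineq X Y E \<I> a b
      \<longleftrightarrow> convex hull (polytope_vertices X Y E \<I>) \<subseteq> {v. scalar_prod X Y E a v \<le> b}"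
    by (auto simp: valid_ineq_def hull)
  also have "\<dots> \<longleftrightarrow> polytope_vertices X Y E \<I> \<subseteq> {v. scalar_prod X Y E a v \<le> b}"
    by (intro subset_hull convex_scalar_prod_le)
  finally show ?thesis by blast
qed

section \<open>Edge sums and the value of an inequality at a vertex\<close>

lemma finite_bipartite_graphD:
  assumes "finite_bipartite_graph X Y E"
  shows "finite X" "finite Y" "X \<inter> Y = {}" "finite E" "\<And>i. i \<in> X \<Longrightarrow> nbhd E i \<subseteq> Y"
    "\<And>e. e \<in> E \<Longrightarrow> \<exists>i\<in>X. \<exists>j\<in>Y. e = {i, j}"
proof -
  show fin: "finite X" "finite Y" and disj: "X \<inter> Y = {}"
    and edge: "\<And>e. e \<in> E \<Longrightarrow> \<exists>i\<in>X. \<exists>j\<in>Y. e = {i, j}"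
    using assms by (auto simp: finite_bipartite_graph_def)
  have "E \<subseteq> Pow (X \<union> Y)" using edge by fastforce
  thus "finite E" using fin by (meson finite_Pow_iff finite_UnI finite_subset)
  show "nbhd E i \<subseteq> Y" if "i \<in> X" for i
  proof
    fix j assume "j \<in> nbhd E i"
    then obtain k l where "k \<in> X" "l \<in> Y" "{i, j} = {k, l}"
      using edge unfolding nbhd_def by blast
    thus "j \<in> Y" using that disj by (auto simp: doubleton_eq_iff)
  qed
qed

text \<open>As \<open>X\<close> and \<open>Y\<close> are disjoint, an edge determines which of its
  ends lies in \<open>X\<close>; edges thus correspond bijectively to pairs of a node in
  \<open>X\<close> and one of its neighbours.\<close>

lemma sum_edges:
  assumes G: "finite_bipartite_graph X Y E"
  shows "(\<Sum>e\<in>E. f e) = (\<Sum>i\<in>X. \<Sum>j\<in>nbhd E i. f {i, j})"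
proof -
  note D = finite_bipartite_graphD[OF G]
  have "bij_betw (\<lambda>(i, j). {i, j}) (Sigma X (nbhd E)) E"
    unfolding bij_betw_def
  proof
    show "inj_on (\<lambda>(i, j). {i, j}) (Sigma X (nbhd E))"
      using D(3,5) by (fastforce simp: inj_on_def doubleton_eq_iff)
    show "(\<lambda>(i, j). {i, j}) ` Sigma X (nbhd E) = E"
      using D(6) by (fastforce simp: nbhd_def)
  qed
  hence "(\<Sum>e\<in>E. f e) = (\<Sum>(i, j)\<in>Sigma X (nbhd E). f {i, j})"
    by (simp add: sum.reindex_bij_betw[symmetric] case_prod_unfold)
  also have "\<dots> = (\<Sum>i\<in>X. \<Sum>j\<in>nbhd E i. f {i, j})"
    using D by (subst sum.Sigma) (auto intro: finite_subset)
  finally show ?thesis .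
qed

text \<open>For fixed \<open>y\<close>, substituting x_i y_j for z_ij turns the left-hand side into
  an affine function of \<open>x\<close>; this is its coefficient at x_i.\<close>

definition node_coeff :: "'v set set \<Rightarrow> 'v xyz_vec \<Rightarrow> ('v \<Rightarrow>\<^sub>0 real) \<Rightarrow> 'v \<Rightarrow> real" where
  "node_coeff E a y i =
     lookup (fst a) i + (\<Sum>j\<in>nbhd E i. lookup (snd (snd a)) {i, j} * lookup y j)"

text \<open>The product equations let each edge term be collected at its end in \<open>X\<close>.
  Since \<open>z\<close> then disappears, values at two vertices can be compared through
  \<open>x\<close> and \<open>y\<close> alone.\<close>

lemma scalar_prod_vertex:
  assumes G: "finite_bipartite_graph X Y E" and v: "(x, y, z) \<in> polytope_vertices X Y E \<I>"
  shows "scalar_prod X Y E a (x, y, z) =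
    (\<Sum>i\<in>X. node_coeff E a y i * lookup x i) + (\<Sum>j\<in>Y. lookup (fst (snd a)) j * lookup y j)"
proof -
  have "lookup z {i, j} = lookup x i * lookup y j" if "i \<in> X" "j \<in> nbhd E i" for i j
    using v that finite_bipartite_graphD(5)[OF G that(1)]
    by (auto simp: polytope_vertices_def nbhd_def)
  hence "(\<Sum>e\<in>E. lookup (snd (snd a)) e * lookup z e) =
      (\<Sum>i\<in>X. (\<Sum>j\<in>nbhd E i. lookup (snd (snd a)) {i, j} * lookup y j) * lookup x i)"
    unfolding sum_edges[OF G] by (simp add: sum_distrib_left algebra_simps)
  thus ?thesis
    by (cases a) (simp add: scalar_prod_def node_coeff_def sum.distrib algebra_simps)
qed

section \<open>Completing and pushing forward binary vectors\<close>

lemma sum_zero_one_cases: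
  fixes f :: "'a \<Rightarrow> real"
  assumes "\<And>i. i \<in> A \<Longrightarrow> f i \<in> {0, 1}" and "sum f A \<le> 1"
  shows "sum f A \<in> {0, 1}"
proof (cases "finite A \<and> (\<exists>i\<in>A. f i = 1)")
  case True
  then obtain i where "finite A" "i \<in> A" "f i = 1" by blast
  hence "1 \<le> sum f A"
    using member_le_sum[of i A f] assms(1) by fastforce
  thus ?thesis using assms(2) by simp
next
  case False
  \<comment> \<open>An infinite \<open>A\<close> also falls under this case; its sum is 0 by
    convention.\<close>
  thus ?thesis using assms(1) by (cases "finite A") (auto intro!: sum.neutral)
qed

lemma ex_vertex:
  assumes G: "finite_bipartite_graph X Y E" and x: "x \<in> X_part X \<I>"
    and y: "keys y \<subseteq> Y" "\<forall>j\<in>Y. lookup y j \<in> {0, 1}"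
  shows "\<exists>z. (x, y, z) \<in> polytope_vertices X Y E \<I>"
proof -
  note D = finite_bipartite_graphD[OF G]
  \<comment> \<open>An edge is an unordered set. Each of \<open>X \<inter> e\<close> and
    \<open>Y \<inter> e\<close> is a singleton, so the two sums read off the values at the ends
    without choosing names for them.\<close>
  obtain z where z: "keys z \<subseteq> E"
    "\<And>e. e \<in> E \<Longrightarrow> lookup z e = (\<Sum>i\<in>X \<inter> e. lookup x i) * (\<Sum>j\<in>Y \<inter> e. lookup y j)"
    using ex_poly_mapping_on[OF D(4), where f = "\<lambda>e. (\<Sum>i\<in>X \<inter> e. lookup x i) * (\<Sum>j\<in>Y \<inter> e. lookup y j)"]
    by blast
  have prod: "lookup z {i, j} = lookup x i * lookup y j" if "i \<in> X" "j \<in> Y" "{i, j} \<in> E" for i j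
  proof -
    have "X \<inter> {i, j} = {i}" "Y \<inter> {i, j} = {j}" using that D(3) by auto
    thus ?thesis using z(2)[OF that(3)] by simp
  qed
  have "lookup z e \<in> {0, 1}" if e: "e \<in> E" for e
  proof -
    obtain i j where ij: "i \<in> X" "j \<in> Y" "e = {i, j}" using D(6)[OF e] by blast
    have "lookup x i \<in> {0, 1}" "lookup y j \<in> {0, 1}"
      using x y ij by (auto simp: X_part_def)
    thus ?thesis using prod[of i j] ij e by auto
  qed
  hence "(x, y, z) \<in> polytope_vertices X Y E \<I>"
    using x y z(1) prod
    by (auto simp: polytope_vertices_def binary_vecs_def vec_space_def X_part_def)
  thus ?thesis ..
qed

text \<open>The witness sums \<open>x\<close> over the fibres of \<open>\<phi>\<close>. The fibres
  over a block of the partition make up exactly that block, so block sums are unchanged and remain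
  at most 1.\<close>

lemma ex_push_forward:
  assumes fin: "finite X" and part: "partition_on X \<I>" and x: "x \<in> X_part X \<I>"
    and \<phi>: "\<And>I i. I \<in> \<I> \<Longrightarrow> i \<in> I \<Longrightarrow> \<phi> i \<in> I"
  shows "\<exists>x'\<in>X_part X \<I>. \<forall>w. (\<Sum>i\<in>X. w (\<phi> i) * lookup x i) = (\<Sum>k\<in>X. w k * lookup x' k)"
proof -
  have sub: "I \<subseteq> X" if "I \<in> \<I>" for I
    using part that by (auto simp: partition_on_def)
  have cover: "\<exists>I\<in>\<I>. i \<in> I" if "i \<in> X" for i
    using part that by (auto simp: partition_on_def)
  \<comment> \<open>Disjointness of the blocks gives the converse of \<open>\<phi>\<close>: a fibre
    over a point of \<open>I\<close> lies inside \<open>I\<close>.\<close>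
  have iff: "\<phi> i \<in> I \<longleftrightarrow> i \<in> I" if i: "i \<in> X" and I: "I \<in> \<I>" for i I
  proof
    assume "\<phi> i \<in> I"
    obtain J where J: "J \<in> \<I>" "i \<in> J" using cover[OF i] by blast
    have "I = J"
      using \<phi>[OF J] \<open>\<phi> i \<in> I\<close> part J I by (auto simp: partition_on_def disjoint_def)
    thus "i \<in> I" using J by simp
  qed (use \<phi> I in auto)
  have \<phi>X: "\<phi> ` X \<subseteq> X"
  proof
    fix k assume "k \<in> \<phi> ` X"
    then obtain i I where "k = \<phi> i" "I \<in> \<I>" "i \<in> I" using cover by fast
    thus "k \<in> X" using \<phi>[of I i] sub[of I] by auto
  qed
  obtain x' where x': "keys x' \<subseteq> X"
    "\<And>k. k \<in> X \<Longrightarrow> lookup x' k = (\<Sum>i\<in>{i\<in>X. \<phi> i = k}. lookup x i)"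
    using ex_poly_mapping_on[OF fin, where f = "\<lambda>k. \<Sum>i\<in>{i\<in>X. \<phi> i = k}. lookup x i"] by blast
  have le1: "(\<Sum>k\<in>I. lookup x' k) \<le> 1" if I: "I \<in> \<I>" for I
  proof -
    have "(\<Sum>k\<in>I. lookup x' k) = (\<Sum>k\<in>I. \<Sum>i\<in>{i\<in>I. \<phi> i = k}. lookup x i)"
    proof (rule sum.cong)
      fix k assume k: "k \<in> I"
      hence "{i\<in>X. \<phi> i = k} = {i\<in>I. \<phi> i = k}"
        using sub[OF I] iff[OF _ I] by auto
      thus "lookup x' k = (\<Sum>i\<in>{i\<in>I. \<phi> i = k}. lookup x i)"
        using x'(2)[of k] k sub[OF I] by auto
    qed simp
    also have "\<dots> = (\<Sum>i\<in>I. lookup x i)"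
      using \<phi>[OF I] finite_subset[OF sub[OF I] fin] by (intro sum.group) auto
    also have "\<dots> \<le> 1" using x I by (simp add: X_part_def)
    finally show ?thesis .
  qed
  have nonneg: "lookup x' k \<ge> 0" if "k \<in> X" for k
    unfolding x'(2)[OF that] using x by (intro sum_nonneg) (force simp: X_part_def)
  \<comment> \<open>By nonnegativity a coordinate is bounded by its block sum; a fibre sum of binary
    values that is at most 1 is itself binary.\<close>
  have "lookup x' k \<in> {0, 1}" if k: "k \<in> X" for k
  proof -
    obtain I where I: "I \<in> \<I>" "k \<in> I" using cover k by blast
    have "lookup x' k \<le> (\<Sum>k\<in>I. lookup x' k)"
      using I(2) finite_subset[OF sub[OF I(1)] fin] nonneg sub[OF I(1)]
      by (intro member_le_sum) auto
    hence "lookup x' k \<le> 1" using le1[OF I(1)] by linarith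
    thus ?thesis
      unfolding x'(2)[OF k] using x by (intro sum_zero_one_cases) (auto simp: X_part_def)
  qed
  hence "x' \<in> X_part X \<I>"
    using x'(1) le1 by (auto simp: X_part_def)
  moreover have "(\<Sum>i\<in>X. w (\<phi> i) * lookup x i) = (\<Sum>k\<in>X. w k * lookup x' k)" for w
  proof -
    \<comment> \<open>On the fibre over \<open>k\<close> the weight \<open>w (\<phi> i)\<close> is
      constantly \<open>w k\<close>.\<close>
    have "(\<Sum>k\<in>X. w k * lookup x' k) = (\<Sum>k\<in>X. \<Sum>i\<in>{i\<in>X. \<phi> i = k}. w (\<phi> i) * lookup x i)"
      by (intro sum.cong) (auto simp: x'(2) sum_distrib_left)
    also have "\<dots> = (\<Sum>i\<in>X. w (\<phi> i) * lookup x i)"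
      using fin \<phi>X by (intro sum.group) auto
    finally show ?thesis by simp
  qed
  ultimately show ?thesis by blast
qed

section \<open>Copyings as node maps that preserve the blocks\<close>

lemma common_nbhd_eq:
  assumes "subset_uniform E \<I>" "I \<in> \<I>" "i \<in> I"
  shows "common_nbhd E I = nbhd E i"
  unfolding common_nbhd_def
proof (rule the_equality)
  show "\<forall>k\<in>I. nbhd E k = nbhd E i"
    using assms unfolding subset_uniform_def by blast
qed (use assms(3) in blast)

text \<open>\<open>\<phi> i\<close> is a node whose tuple was copied to \<open>i\<close>. Both lie
  in one block and so have the same neighbours, hence equal tuples yield equal node coefficients,
  whatever \<open>y\<close> is.\<close>

lemma copying_node_map:
  assumes part: "partition_on X \<I>" and unif: "subset_uniform E \<I>"
    and copy: "is_copying X Y E \<I> a a'"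
  obtains \<phi> where "\<And>I i. I \<in> \<I> \<Longrightarrow> i \<in> I \<Longrightarrow> \<phi> i \<in> I"
    and "\<And>y i. i \<in> X \<Longrightarrow> node_coeff E a' y i = node_coeff E a y (\<phi> i)"
proof -
  \<comment> \<open>Blocks and \<open>y\<close> are quantified inside the existential, so that the
    node chosen depends on \<open>i\<close> only.\<close>
  have "\<exists>k. (\<forall>I\<in>\<I>. i \<in> I \<longrightarrow> k \<in> I) \<and> (\<forall>y. node_coeff E a' y i = node_coeff E a y k)"
    if i: "i \<in> X" for i
  proof -
    obtain I where I: "I \<in> \<I>" "i \<in> I" using part i by (auto simp: partition_on_def)
    have "coeff_tuple (common_nbhd E I) a' i \<in> coeff_tuples E a I"
      using copy I by (simp add: is_copying_def)
    then obtain k where k: "k \<in> I"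
      and eq: "coeff_tuple (common_nbhd E I) a' i = coeff_tuple (common_nbhd E I) a k"
      by (auto simp: coeff_tuples_def)
    have N: "common_nbhd E I = nbhd E i" "nbhd E k = nbhd E i"
      using common_nbhd_eq[OF unif I(1)] I(2) k by metis+
    have "lookup (fst a') i = lookup (fst a) k"
      using eq by (cases a; cases a') (simp add: coeff_tuple_def)
    moreover have "lookup (snd (snd a')) {i, j} = lookup (snd (snd a)) {k, j}"
      if "j \<in> nbhd E i" for j
      \<comment> \<open>The second component of a tuple is a restricted function, informative only
        at neighbours \<open>j\<close>.\<close>
      using fun_cong[OF arg_cong[OF eq[unfolded N], of snd], of j] that
      by (cases a; cases a') (simp add: coeff_tuple_def)
    ultimately have "node_coeff E a' y i = node_coeff E a y k" for y
      by (simp add: node_coeff_def N)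
    moreover have "k \<in> J" if "J \<in> \<I>" "i \<in> J" for J
    proof -
      have "J = I" using part I that by (auto simp: partition_on_def disjoint_def)
      thus ?thesis using k by simp
    qed
    ultimately show ?thesis by blast
  qed
  then obtain \<phi> where \<phi>: "\<And>i. i \<in> X \<Longrightarrow> (\<forall>I\<in>\<I>. i \<in> I \<longrightarrow> \<phi> i \<in> I) \<and>
      (\<forall>y. node_coeff E a' y i = node_coeff E a y (\<phi> i))"
    by metis
  show thesis
  proof (rule that[of \<phi>])
    show "\<phi> i \<in> I" if "I \<in> \<I>" "i \<in> I" for I i
      using \<phi>[of i] that part by (auto simp: partition_on_def)
  qed (use \<phi> in auto)
qed

theorem proposition2p8:
  fixes X Y :: "'v set" and E :: "'v set set" and \<I> :: "'v set set"
    and a a' :: "'v xyz_vec" and b :: real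
  assumes "finite_bipartite_graph X Y E"
    and "partition_on X \<I>"
    and "subset_uniform E \<I>"
    and "a \<in> vec_space X Y E"
    and "valid_ineq X Y E \<I> a b"
    and "is_copying X Y E \<I> a a'"
  shows "valid_ineq X Y E \<I> a' b"
  unfolding valid_ineq_iff_vertices
proof
  fix v assume v: "v \<in> polytope_vertices X Y E \<I>"
  obtain x y z where v_eq: "v = (x, y, z)" by (cases v)
  note v = v[unfolded v_eq]
  have x: "x \<in> X_part X \<I>" and y: "keys y \<subseteq> Y" "\<forall>j\<in>Y. lookup y j \<in> {0, 1}"
    using v by (auto simp: polytope_vertices_def binary_vecs_def vec_space_def)
  obtain \<phi> where \<phi>: "\<And>I i. I \<in> \<I> \<Longrightarrow> i \<in> I \<Longrightarrow> \<phi> i \<in> I"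
    and coeff: "\<And>y i. i \<in> X \<Longrightarrow> node_coeff E a' y i = node_coeff E a y (\<phi> i)"
    using copying_node_map[OF assms(2,3,6)] by metis
  obtain x' where x': "x' \<in> X_part X \<I>"
    and push: "\<And>w. (\<Sum>i\<in>X. w (\<phi> i) * lookup x i) = (\<Sum>k\<in>X. w k * lookup x' k)"
    using ex_push_forward[OF finite_bipartite_graphD(1)[OF assms(1)] assms(2) x, of \<phi>] \<phi> by blast
  \<comment> \<open>Keeping \<open>y\<close> fixed preserves both the \<open>Y\<close>-term and the
    node coefficients.\<close>
  obtain z' where v': "(x', y, z') \<in> polytope_vertices X Y E \<I>"
    using ex_vertex[OF assms(1) x' y] by blast
  have "(\<Sum>j\<in>Y. lookup (fst (snd a')) j * lookup y j) = (\<Sum>j\<in>Y. lookup (fst (snd a)) j * lookup y j)"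
    using assms(6) by (intro sum.cong) (auto simp: is_copying_def)
  hence "scalar_prod X Y E a' (x, y, z) = scalar_prod X Y E a (x', y, z')"
    \<comment> \<open>The weights are the node coefficients of the original; \<open>coeff\<close>
      rewrites those of the copying as these weights at \<open>\<phi> i\<close>.\<close>
    using push[of "node_coeff E a y"]
    by (simp add: scalar_prod_vertex[OF assms(1) v] scalar_prod_vertex[OF assms(1) v'] coeff)
  also have "\<dots> \<le> b"
    using assms(5) v' unfolding valid_ineq_iff_vertices by blast
  finally show "scalar_prod X Y E a' v \<le> b" by (simp add: v_eq)
qed

end
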